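(* Let $n\geq 2$ and $\Delta\geq 1$ be integers. (1) If $\Delta n$ is even, then for each connected graph $G$ of order $n$ with maximum degree $\Delta$, $$ABS(G)\leq\frac{n}{2}\sqrt{\Delta(\Delta-1)},$$ with equality if and only if $G$ is $\Delta$-regular. (2) If $\Delta n$ is odd, then for each connected graph $G$ of order $n$ with maximum degree $\Delta$, $$ABS(G)\leq(\Delta-1)\sqrt{\frac{2\Delta-3}{2\Delta-1}}+\frac{\Delta n-2\Delta+1}{2}\sqrt{\frac{\Delta-1}{\Delta}},$$ with equality if and only if $G$ is nearly $\Delta$-regular.
   Context: All graphs are finite and simple. For a graph $G$ with vertex degrees $d_v$, the atom-bond sum-connectivity index is $ABS(G)=\sum_{uv\in E(G)}\left(\frac{d_u+d_v-2}{d_u+d_v}\right)^{1/2}$. A graph of order $n$ is $r$-regular if all its vertices have degree $r$, and nearly $r$-regular if it has exactly one vertex of degree $r-1$ and its other $n-1$ vertices have degree $r$. *)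

theory Defs
  imports Complex_Main "Graph_Theory.Digraph_Component"
begin

text \<open>
  A finite simple graph is a \<^locale>\<open>graph\<close>: a finite symmetric digraph without loops and
  parallel arcs. An edge \<open>uv\<close> thus gives the two arcs \<open>(u,v)\<close> and \<open>(v,u)\<close>; \<open>edges\<close> identifies
  these, so that sums over \<open>edges\<close> count each edge once.
\<close>

definition edges :: "('a, 'b) pre_digraph \<Rightarrow> 'a set set" where
  "edges G = (\<lambda>e. {tail G e, head G e}) ` arcs G"

text \<open>The arcs leaving \<open>v\<close> correspond one-to-one to the edges incident with \<open>v\<close>.\<close>

abbreviation vdegree :: "('a, 'b) pre_digraph \<Rightarrow> 'a \<Rightarrow> nat" where
  "vdegree G v \<equiv> out_degree G v"

definition max_degree :: "('a, 'b) pre_digraph \<Rightarrow> nat" where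
  "max_degree G = Max (vdegree G ` verts G)"

definition abs_weight :: "('a, 'b) pre_digraph \<Rightarrow> 'a set \<Rightarrow> real" where
  "abs_weight G e =
    sqrt (((\<Sum>v\<in>e. real (vdegree G v)) - 2) / (\<Sum>v\<in>e. real (vdegree G v)))"

definition ABS_index :: "('a, 'b) pre_digraph \<Rightarrow> real" where
  "ABS_index G = (\<Sum>e\<in>edges G. abs_weight G e)"

lemma abs_weight_doubleton:
  assumes "u \<noteq> v"
  shows "abs_weight G {u, v} =
    sqrt ((real (vdegree G u) + real (vdegree G v) - 2) / (real (vdegree G u) + real (vdegree G v)))"
  using assms by (simp add: abs_weight_def)

definition regular :: "nat \<Rightarrow> ('a, 'b) pre_digraph \<Rightarrow> bool" where
  "regular r G \<longleftrightarrow> (\<forall>v\<in>verts G. vdegree G v = r)"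

text \<open>Degree \<open>r - 1\<close> is written additively to avoid truncated subtraction.\<close>

definition nearly_regular :: "nat \<Rightarrow> ('a, 'b) pre_digraph \<Rightarrow> bool" where
  "nearly_regular r G \<longleftrightarrow>
    (\<exists>v\<in>verts G. vdegree G v + 1 = r \<and> (\<forall>u\<in>verts G - {v}. vdegree G u = r))"

end

theory Submission
  imports Defs
begin

text \<open>
  Writing \<open>c = sqrt ((\<Delta> - 1) / \<Delta>)\<close>, every edge has weight at most \<open>c\<close>, since \<open>1 - 2 / s\<close>
  increases with the degree sum \<open>s \<le> 2 \<Delta>\<close>; so \<open>ABS \<le> c m\<close> for the number \<open>m\<close> of edges, and
  \<open>m \<le> \<Delta> n / 2\<close>. If \<open>\<Delta> n\<close> is odd, then either the degree sum is \<open>\<Delta> n - 1\<close>, which forces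
  near regularity and an exact value of the index, or by parity it is at most \<open>\<Delta> n - 3\<close>.
  In the latter case already the crude bound \<open>c (\<Delta> n - 3) / 2\<close> is strictly below the claimed
  one, because \<open>(\<Delta> - 2) c < (\<Delta> - 1) sqrt ((2 \<Delta> - 3) / (2 \<Delta> - 1))\<close>.
\<close>

context graph
begin

section \<open>Arcs, edges and degrees\<close>

lemma sum_arcs_eq_twice_sum_edges:
  fixes g :: "'a set \<Rightarrow> real"
  shows "(\<Sum>e\<in>arcs G. g {tail G e, head G e}) = 2 * (\<Sum>E\<in>edges G. g E)"
proof -
  let ?f = "\<lambda>e. {tail G e, head G e}"
  \<comment> \<open>The fibre over an edge consists of an arc and its reverse. These differ because
    there are no loops, and absence of parallel arcs excludes a third.\<close>
  have two: "card {e \<in> arcs G. ?f e = E} = 2" if E: "E \<in> edges G" for E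
  proof -
    obtain e where e: "e \<in> arcs G" "E = ?f e" using E unfolding edges_def by blast
    obtain e' where e': "e' \<in> arcs G" "tail G e = head G e'" "head G e = tail G e'"
      using sym_arcs e(1) unfolding symmetric_conv by blast
    have "e \<noteq> e'" using no_loops[OF e(1)] e' by auto
    moreover have "{x \<in> arcs G. ?f x = E} = {e, e'}"
    proof (intro subset_antisym subsetI)
      fix x assume "x \<in> {x \<in> arcs G. ?f x = E}"
      then have x: "x \<in> arcs G" "?f x = ?f e" using e by auto
      then have "arc_to_ends G x = arc_to_ends G e \<or> arc_to_ends G x = arc_to_ends G e'"
        using e' unfolding arc_to_ends_def by (auto simp: doubleton_eq_iff)
      then show "x \<in> {e, e'}" using no_multi_arcs x(1) e(1) e'(1) by blast
    qed (use e e' in auto)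
    ultimately show ?thesis by simp
  qed
  have "(\<Sum>e\<in>arcs G. g (?f e)) = (\<Sum>E\<in>edges G. \<Sum>e\<in>{e \<in> arcs G. ?f e = E}. g (?f e))"
    unfolding edges_def by (rule sum.image_gen) simp
  also have "\<dots> = (\<Sum>E\<in>edges G. 2 * g E)"
    by (rule sum.cong) (simp_all add: two)
  finally show ?thesis by (simp add: sum_distrib_left)
qed

text \<open>Constant weight 1 in the edge-to-arc conversion. This is the only source of parity for
  odd \<open>\<Delta> * n\<close>.\<close>

lemma even_card_arcs: "even (card (arcs G))"
proof -
  have "real (card (arcs G)) = real (2 * card (edges G))"
    using sum_arcs_eq_twice_sum_edges[of "\<lambda>_. 1"] by simp
  then show ?thesis by (metis of_nat_eq_iff dvd_triv_left)
qed

lemma sum_vdegree: "(\<Sum>v\<in>verts G. vdegree G v) = card (arcs G)"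
proof -
  have "card (arcs G) = (\<Sum>v\<in>verts G. \<Sum>e\<in>{e \<in> arcs G. tail G e = v}. 1)"
    using sum.group[of "arcs G" "verts G" "tail G" "\<lambda>_. 1::nat"] by force
  then show ?thesis by (simp add: out_degree_def out_arcs_def)
qed

lemma vdegree_le_max_degree: "v \<in> verts G \<Longrightarrow> vdegree G v \<le> max_degree G"
  unfolding max_degree_def by (rule Max_ge) auto

lemma vdegree_tail_pos: "e \<in> arcs G \<Longrightarrow> vdegree G (tail G e) \<ge> 1"
  using finite_out_arcs[of "tail G e"] card_gt_0_iff[of "out_arcs G (tail G e)"]
  unfolding out_degree_def by force

lemma vdegree_head_pos:
  assumes "e \<in> arcs G" shows "vdegree G (head G e) \<ge> 1"
proof -
  obtain e' where "e' \<in> arcs G" "head G e = tail G e'"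
    using sym_arcs assms unfolding symmetric_conv by blast
  then show ?thesis using vdegree_tail_pos[of e'] by simp
qed

text \<open>Reversing arcs identifies in-neighbours with out-neighbours, and without parallel arcs
  each neighbour accounts for one arc in either direction. It serves to count all arcs touching a
  vertex.\<close>

lemma in_degree_eq_vdegree: "in_degree G v = vdegree G v"
proof -
  have inv: "\<exists>e'\<in>arcs G. tail G e' = head G e \<and> head G e' = tail G e" if "e \<in> arcs G" for e
    using sym_arcs that unfolding symmetric_conv by metis
  have inj: "inj_on (\<lambda>e. (tail G e, head G e)) (arcs G)"
    using inj_on_arc_to_ends unfolding arc_to_ends_def .
  have "card (in_arcs G v) = card (tail G ` in_arcs G v)"
    by (rule card_image[symmetric]) (use inj in \<open>auto simp: inj_on_def\<close>)
  also have "tail G ` in_arcs G v = head G ` out_arcs G v"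
    using inv by (force simp: image_iff)
  also have "card \<dots> = card (out_arcs G v)"
    by (rule card_image) (use inj in \<open>auto simp: inj_on_def\<close>)
  finally show ?thesis unfolding in_degree_def out_degree_def .
qed

text \<open>The first arc of a walk to a second vertex leaves \<open>v\<close>. This settles
  \<Delta> = 1, where every possible edge weight is 0 and the index cannot detect missing
  edges.\<close>

lemma connected_vdegree_pos:
  assumes conn: "Digraph_Component.connected G" and card: "card (verts G) \<ge> 2" and v: "v \<in> verts G"
  shows "vdegree G v \<ge> 1"
proof -
  obtain u where u: "u \<in> verts G" "u \<noteq> v"
    using card v by (metis card_le_Suc0_iff_eq finite_verts not_less_eq_eq numeral_2_eq_2)
  have "v \<rightarrow>\<^sup>*\<^bsub>G\<^esub> u"
    using symmetric_connected_imp_strongly_connected[OF sym_arcs conn] u(1) v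
    unfolding strongly_connected_def by blast
  then obtain w where "v \<rightarrow>\<^bsub>G\<^esub> w" using u(2) by (cases rule: converse_reachable_cases) auto
  then show ?thesis using vdegree_tail_pos by auto
qed

section \<open>Upper bounds for the index and the arc count\<close>

lemma ABS_index_arcs: "2 * ABS_index G = (\<Sum>e\<in>arcs G. abs_weight G {tail G e, head G e})"
  unfolding ABS_index_def sum_arcs_eq_twice_sum_edges ..

lemma abs_weight_arc_le:
  assumes e: "e \<in> arcs G" and max: "max_degree G = \<Delta>"
  shows "abs_weight G {tail G e, head G e} \<le> sqrt ((real \<Delta> - 1) / real \<Delta>)"
proof -
  let ?x = "real (vdegree G (tail G e))" and ?y = "real (vdegree G (head G e))"
  have "?x \<ge> 1" "?y \<ge> 1" using vdegree_tail_pos[OF e] vdegree_head_pos[OF e] by linarith+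
  moreover have "?x \<le> \<Delta>" "?y \<le> \<Delta>" using vdegree_le_max_degree e max by auto
  \<comment> \<open>The lower bounds make all denominators positive; cross-multiplication then
    leaves \<open>?x + ?y \<le> 2 * \<Delta>\<close>.\<close>
  ultimately have "(?x + ?y - 2) / (?x + ?y) \<le> (real \<Delta> - 1) / real \<Delta>"
    by (simp add: field_simps)
  then show ?thesis by (simp add: abs_weight_doubleton no_loops[OF e])
qed

lemma ABS_index_le_card_arcs:
  assumes "max_degree G = \<Delta>"
  shows "2 * ABS_index G \<le> real (card (arcs G)) * sqrt ((real \<Delta> - 1) / real \<Delta>)"
  unfolding ABS_index_arcs
  by (rule sum_bounded_above) (use assms abs_weight_arc_le in blast)

lemma card_arcs_le:
  assumes "max_degree G = \<Delta>"
  shows "card (arcs G) \<le> \<Delta> * card (verts G)"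
  using sum_bounded_above[of "verts G" "vdegree G" \<Delta>] vdegree_le_max_degree assms
  by (simp add: sum_vdegree mult.commute)

text \<open>The total defect decides the extremal graphs: 0 means regular, 1 means nearly regular.
  Truncated subtraction is exact here, as no degree exceeds \<Delta>.\<close>

lemma sum_defect:
  assumes "max_degree G = \<Delta>"
  shows "(\<Sum>v\<in>verts G. \<Delta> - vdegree G v) = \<Delta> * card (verts G) - card (arcs G)"
  using sum_subtractf_nat[of "verts G" "vdegree G" "\<lambda>_. \<Delta>"] vdegree_le_max_degree assms
  by (simp add: sum_vdegree mult.commute)

lemma card_arcs_eq_iff_regular:
  assumes max: "max_degree G = \<Delta>"
  shows "card (arcs G) = \<Delta> * card (verts G) \<longleftrightarrow> regular \<Delta> G"
proof -
  have "card (arcs G) = \<Delta> * card (verts G) \<longleftrightarrow> (\<Sum>v\<in>verts G. \<Delta> - vdegree G v) = 0"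
    using card_arcs_le[OF max] unfolding sum_defect[OF max] by linarith
  also have "\<dots> \<longleftrightarrow> (\<forall>v\<in>verts G. vdegree G v = \<Delta>)"
    using vdegree_le_max_degree max by (auto simp: le_antisym)
  finally show ?thesis unfolding regular_def .
qed

text \<open>A total defect of one cannot be split among natural numbers, so it sits at a single
  vertex.\<close>

lemma card_arcs_eq_iff_nearly_regular:
  assumes max: "max_degree G = \<Delta>" and "\<Delta> \<ge> 1"
  shows "card (arcs G) + 1 = \<Delta> * card (verts G) \<longleftrightarrow> nearly_regular \<Delta> G"
proof -
  have "card (arcs G) + 1 = \<Delta> * card (verts G) \<longleftrightarrow> (\<Sum>v\<in>verts G. \<Delta> - vdegree G v) = 1"
    using card_arcs_le[OF max] unfolding sum_defect[OF max] by linarith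
  also have "\<dots> \<longleftrightarrow> (\<exists>v\<in>verts G. \<Delta> - vdegree G v = 1 \<and> (\<forall>u\<in>verts G. v \<noteq> u \<longrightarrow> \<Delta> - vdegree G u = 0))"
    by (rule sum_eq_1_iff) simp
  also have "\<dots> \<longleftrightarrow> nearly_regular \<Delta> G"
    unfolding nearly_regular_def
  proof (intro bex_cong conj_cong refl)
    fix v assume "v \<in> verts G"
    then show "\<Delta> - vdegree G v = 1 \<longleftrightarrow> vdegree G v + 1 = \<Delta>"
      by linarith
    show "(\<forall>u\<in>verts G. v \<noteq> u \<longrightarrow> \<Delta> - vdegree G u = 0) \<longleftrightarrow> (\<forall>u\<in>verts G - {v}. vdegree G u = \<Delta>)"
      using vdegree_le_max_degree max by (auto simp: le_antisym)
  qed
  finally show ?thesis .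
qed

section \<open>Exact values for the extremal graphs\<close>

lemma ABS_index_regular:
  assumes "regular \<Delta> G"
  shows "2 * ABS_index G = real (card (arcs G)) * sqrt ((real \<Delta> - 1) / real \<Delta>)"
proof -
  have "abs_weight G {tail G e, head G e} = sqrt ((real \<Delta> - 1) / real \<Delta>)" if "e \<in> arcs G" for e
  proof -
    have "(real \<Delta> + real \<Delta> - 2) / (real \<Delta> + real \<Delta>) = (real \<Delta> - 1) / real \<Delta>"
      \<comment> \<open>For \<Delta> = 0 both sides are divisions by zero, hence 0.\<close>
      by (cases "\<Delta> = 0") (simp_all add: field_simps)
    then show ?thesis
      using assms that no_loops[OF that] by (simp add: abs_weight_doubleton regular_def)
  qed
  then show ?thesis unfolding ABS_index_arcs by simp
qed

lemma ABS_index_nearly_regular: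
  assumes nr: "nearly_regular \<Delta> G" and max: "max_degree G = \<Delta>" and \<Delta>: "\<Delta> \<ge> 1"
  shows "2 * ABS_index G = 2 * (real \<Delta> - 1) * sqrt ((2 * real \<Delta> - 3) / (2 * real \<Delta> - 1))
    + (real \<Delta> * real (card (verts G)) - 2 * real \<Delta> + 1) * sqrt ((real \<Delta> - 1) / real \<Delta>)"
proof -
  obtain v where v: "v \<in> verts G" "vdegree G v + 1 = \<Delta>" "\<And>u. u \<in> verts G \<Longrightarrow> u \<noteq> v \<Longrightarrow> vdegree G u = \<Delta>"
    using nr unfolding nearly_regular_def by auto
  \<comment> \<open>For \<Delta> = 1 the radicand is -1, which is harmless: \<open>v\<close> is then
    isolated, so no arc has this weight and its coefficient is 0.\<close>
  define a where "a = sqrt ((2 * real \<Delta> - 3) / (2 * real \<Delta> - 1))"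
  define c where "c = sqrt ((real \<Delta> - 1) / real \<Delta>)"
  let ?w = "\<lambda>e. abs_weight G {tail G e, head G e}"
  let ?B = "out_arcs G v \<union> in_arcs G v"
  have B: "?B \<subseteq> arcs G" by auto
  have dv: "real (vdegree G v) = real \<Delta> - 1" using v(2) by linarith
  \<comment> \<open>An arc both leaving and entering \<open>v\<close> would be a loop.\<close>
  have "card ?B = card (out_arcs G v) + card (in_arcs G v)"
    by (rule card_Un_disjoint) (auto dest: no_loops)
  then have cardB: "card ?B = 2 * vdegree G v"
    using in_degree_eq_vdegree[of v] unfolding in_degree_def out_degree_def by simp
  have a: "?w e = a" if "e \<in> ?B" for e
  proof -
    have e: "e \<in> arcs G" using that by auto
    have "real (vdegree G (tail G e)) + real (vdegree G (head G e)) = 2 * real \<Delta> - 1"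
      using that v(3) no_loops[OF e] dv e by auto
    then show ?thesis using no_loops[OF e] by (simp add: abs_weight_doubleton a_def)
  qed
  have c: "?w e = c" if "e \<in> arcs G - ?B" for e
  proof -
    have e: "e \<in> arcs G" using that by auto
    have "vdegree G (tail G e) = \<Delta>" "vdegree G (head G e) = \<Delta>"
      using that v(3) by auto
    moreover have "(real \<Delta> + real \<Delta> - 2) / (real \<Delta> + real \<Delta>) = (real \<Delta> - 1) / real \<Delta>"
      using \<Delta> by (simp add: field_simps)
    ultimately show ?thesis using no_loops[OF e] by (simp add: abs_weight_doubleton c_def)
  qed
  have "2 * ABS_index G = sum ?w (arcs G - ?B) + sum ?w ?B"
    unfolding ABS_index_arcs by (rule sum.subset_diff) (use B in auto)
  also have "\<dots> = real (card (arcs G - ?B)) * c + real (card ?B) * a"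
    using a c by simp
  also have "real (card (arcs G - ?B)) = real (card (arcs G)) - real (card ?B)"
    by (metis B card_Diff_subset card_mono finite_arcs finite_subset of_nat_diff)
  \<comment> \<open>Removing the 2 (\<Delta> - 1) arcs at \<open>v\<close> from \<Delta> n - 1
    leaves the coefficient \<Delta> n - 2 \<Delta> + 1.\<close>
  also have "real (card (arcs G)) = real \<Delta> * real (card (verts G)) - 1"
    using card_arcs_eq_iff_nearly_regular[OF max \<Delta>] nr
    by (metis add_diff_cancel_right' of_nat_1 of_nat_add of_nat_mult)
  finally show ?thesis
    unfolding cardB a_def[symmetric] c_def[symmetric] using dv by (simp add: algebra_simps)
qed

section \<open>The regular bound and its equality case\<close>

lemma ABS_index_even:
  assumes conn: "Digraph_Component.connected G" and n: "card (verts G) = n" "n \<ge> 2"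
    and max: "max_degree G = \<Delta>" and \<Delta>: "\<Delta> \<ge> 1"
  shows "ABS_index G \<le> real n / 2 * sqrt (real \<Delta> * (real \<Delta> - 1))"
    and "ABS_index G = real n / 2 * sqrt (real \<Delta> * (real \<Delta> - 1)) \<longleftrightarrow> regular \<Delta> G"
proof -
  define c where "c = sqrt ((real \<Delta> - 1) / real \<Delta>)"
  \<comment> \<open>This \<open>m\<close> counts arcs, so it is twice the number of edges.\<close>
  define m where "m = card (arcs G)"
  have "sqrt (real \<Delta> * (real \<Delta> - 1)) = sqrt ((real \<Delta>)\<^sup>2 * ((real \<Delta> - 1) / real \<Delta>))"
    using \<Delta> by (simp add: power2_eq_square)
  then have rhs: "real n / 2 * sqrt (real \<Delta> * (real \<Delta> - 1)) = real (\<Delta> * n) * c / 2"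
    by (simp only: real_sqrt_mult real_sqrt_abs c_def) simp
  have c0: "c \<ge> 0" using \<Delta> by (simp add: c_def)
  have m: "m \<le> \<Delta> * n" using card_arcs_le[OF max] n by (simp add: m_def)
  have le: "2 * ABS_index G \<le> real m * c"
    using ABS_index_le_card_arcs[OF max] by (simp add: c_def m_def)
  have mc: "real m * c \<le> real (\<Delta> * n) * c"
    using m c0 by (intro mult_right_mono) linarith+
  show "ABS_index G \<le> real n / 2 * sqrt (real \<Delta> * (real \<Delta> - 1))"
    using le mc rhs by linarith
  show "ABS_index G = real n / 2 * sqrt (real \<Delta> * (real \<Delta> - 1)) \<longleftrightarrow> regular \<Delta> G"
  proof
    assume "regular \<Delta> G"
    then have "2 * ABS_index G = real m * c" "m = \<Delta> * n"
      using ABS_index_regular card_arcs_eq_iff_regular[OF max] n by (auto simp: c_def m_def)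
    then show "ABS_index G = real n / 2 * sqrt (real \<Delta> * (real \<Delta> - 1))"
      unfolding rhs by simp
  next
    assume eq: "ABS_index G = real n / 2 * sqrt (real \<Delta> * (real \<Delta> - 1))"
    show "regular \<Delta> G"
    \<comment> \<open>Equality can be cancelled to an equality of arc counts only if
      \<open>c > 0\<close>. For \<Delta> = 1 connectedness forces every degree to be 1
      instead.\<close>
    proof (cases "\<Delta> = 1")
      case True
      then show ?thesis
        using connected_vdegree_pos[OF conn] n vdegree_le_max_degree max
        unfolding regular_def by (metis le_antisym)
    next
      case False
      then have "c > 0" using \<Delta> by (simp add: c_def)
      moreover have "real (\<Delta> * n) * c \<le> real m * c" using eq rhs le by linarith
      ultimately have "real (\<Delta> * n) \<le> real m" by simp
      then have "\<Delta> * n \<le> m" by linarith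
      then show ?thesis using m card_arcs_eq_iff_regular[OF max] n by (simp add: m_def)
    qed
  qed
qed

end

section \<open>The bound for odd \<open>\<Delta> * n\<close>\<close>

lemma crude_bound_less:
  fixes d :: real
  assumes "d \<ge> 2"
  shows "(d - 2) * sqrt ((d - 1) / d) < (d - 1) * sqrt ((2 * d - 3) / (2 * d - 1))"
proof -
  have "(d - 2)\<^sup>2 * (d - 1) * (2 * d - 1) < (d - 1)\<^sup>2 * (2 * d - 3) * d"
  proof -
    \<comment> \<open>After squaring, the difference of the two sides has this quadratic as its
      essential factor; expanding around 2 makes its positivity visible.\<close>
    have "4 * d\<^sup>2 - 9 * d + 4 = 4 * (d - 2)\<^sup>2 + (7 * (d - 2) + 2)"
      by (simp add: power2_eq_square algebra_simps)
    also have "\<dots> > 0" using assms by (intro add_nonneg_pos) simp_all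
    finally have "0 < (d - 1) * (4 * d\<^sup>2 - 9 * d + 4)"
      using assms by (intro mult_pos_pos) simp_all
    also have "\<dots> = (d - 1)\<^sup>2 * (2 * d - 3) * d - (d - 2)\<^sup>2 * (d - 1) * (2 * d - 1)"
      by (simp add: power2_eq_square algebra_simps)
    finally show ?thesis by simp
  qed
  then have "(d - 2)\<^sup>2 * ((d - 1) / d) < (d - 1)\<^sup>2 * ((2 * d - 3) / (2 * d - 1))"
    using assms by (simp add: divide_simps mult.commute mult.left_commute)
  then have "sqrt ((d - 2)\<^sup>2 * ((d - 1) / d)) < sqrt ((d - 1)\<^sup>2 * ((2 * d - 3) / (2 * d - 1)))"
    by (rule real_sqrt_less_mono)
  then show ?thesis using assms unfolding real_sqrt_mult real_sqrt_abs by simp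
qed

text \<open>Nearly regular graphs attain \<open>b\<close> exactly and all others stay strictly below
  it, which gives the bound and the equality case together.\<close>

lemma (in graph) ABS_index_odd:
  assumes conn: "Digraph_Component.connected G" and n: "card (verts G) = n" "n \<ge> 2"
    and max: "max_degree G = \<Delta>" and \<Delta>: "\<Delta> \<ge> 1" and odd: "odd (\<Delta> * n)"
  defines "b \<equiv> (real \<Delta> - 1) * sqrt ((2 * real \<Delta> - 3) / (2 * real \<Delta> - 1))
    + (real \<Delta> * real n - 2 * real \<Delta> + 1) / 2 * sqrt ((real \<Delta> - 1) / real \<Delta>)"
  shows "ABS_index G \<le> b \<and> (ABS_index G = b \<longleftrightarrow> nearly_regular \<Delta> G)"
proof (cases "nearly_regular \<Delta> G")
  case True
  have "2 * ABS_index G = 2 * b"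
    unfolding ABS_index_nearly_regular[OF True max \<Delta>] b_def n by (simp add: distrib_left)
  then show ?thesis using True by simp
next
  case False
  define c where "c = sqrt ((real \<Delta> - 1) / real \<Delta>)"
  \<comment> \<open>For \<Delta> = 1 a connected graph would be 1-regular with an odd number of
    arcs.\<close>
  have "\<Delta> \<noteq> 1"
  proof
    assume "\<Delta> = 1"
    then have "regular \<Delta> G"
      using connected_vdegree_pos[OF conn] n vdegree_le_max_degree max
      unfolding regular_def by (metis le_antisym)
    then show False
      using card_arcs_eq_iff_regular[OF max] n even_card_arcs odd by simp
  qed
  then have "\<Delta> \<ge> 2" using \<Delta> by simp
  have ne: "card (arcs G) + 1 \<noteq> \<Delta> * n"
    using False card_arcs_eq_iff_nearly_regular[OF max \<Delta>] n by simp
  have "card (arcs G) \<le> \<Delta> * n" using card_arcs_le[OF max] n by simp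
  \<comment> \<open>The defect is odd, as an odd number minus an even one, and it is not 1.\<close>
  then have "card (arcs G) + 3 \<le> \<Delta> * n"
    using even_card_arcs odd ne by presburger
  then have "real (card (arcs G)) \<le> real \<Delta> * real n - 3"
    by (simp flip: of_nat_mult)
  then have "real (card (arcs G)) * c \<le> (real \<Delta> * real n - 3) * c"
    using \<Delta> by (intro mult_right_mono) (auto simp: c_def)
  then have "2 * ABS_index G \<le> (real \<Delta> * real n - 3) * c"
    using ABS_index_le_card_arcs[OF max] by (simp add: c_def)
  \<comment> \<open>The split isolates the second summand of \<open>2 * b\<close>, so only the
    comparison of \<open>crude_bound_less\<close> remains.\<close>
  also have "\<dots> = 2 * ((real \<Delta> - 2) * c) + (real \<Delta> * real n - 2 * real \<Delta> + 1) * c"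
    by (simp add: algebra_simps)
  also have "\<dots> < 2 * b"
    using crude_bound_less[of "real \<Delta>"] \<open>\<Delta> \<ge> 2\<close> unfolding b_def c_def by simp
  finally show ?thesis using False by simp
qed

theorem theorem2:
  fixes n \<Delta> :: nat
  assumes "n \<ge> 2" and "\<Delta> \<ge> 1"
  shows
    "(even (\<Delta> * n) \<longrightarrow>
       (\<forall>G :: ('a, 'b) pre_digraph.
          graph G \<and> Digraph_Component.connected G \<and> card (verts G) = n \<and> max_degree G = \<Delta> \<longrightarrow>
            ABS_index G \<le> real n / 2 * sqrt (real \<Delta> * (real \<Delta> - 1)) \<and>
            (ABS_index G = real n / 2 * sqrt (real \<Delta> * (real \<Delta> - 1)) \<longleftrightarrow> regular \<Delta> G)))
     \<and>
     (odd (\<Delta> * n) \<longrightarrow>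
       (\<forall>G :: ('a, 'b) pre_digraph.
          graph G \<and> Digraph_Component.connected G \<and> card (verts G) = n \<and> max_degree G = \<Delta> \<longrightarrow>
            ABS_index G \<le> (real \<Delta> - 1) * sqrt ((2 * real \<Delta> - 3) / (2 * real \<Delta> - 1))
                + (real \<Delta> * real n - 2 * real \<Delta> + 1) / 2 * sqrt ((real \<Delta> - 1) / real \<Delta>) \<and>
            (ABS_index G = (real \<Delta> - 1) * sqrt ((2 * real \<Delta> - 3) / (2 * real \<Delta> - 1))
                + (real \<Delta> * real n - 2 * real \<Delta> + 1) / 2 * sqrt ((real \<Delta> - 1) / real \<Delta>)
              \<longleftrightarrow> nearly_regular \<Delta> G)))"
  using graph.ABS_index_even graph.ABS_index_odd assms by blast

end
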